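(* Let $n\ge 1$, let $\sigma\in\mathcal{S}_n(231)$, and let $\Phi:\mathcal{S}_n(231)\to\mathcal{D}_n$ be the bijection defined in the context. Then $$\operatorname{Set}_X(\Phi(\sigma))=\operatorname{Des}(\sigma),\qquad \operatorname{Set}_Y(\Phi(\sigma))=\operatorname{iDes}(\sigma),$$ and, in particular, $$\operatorname{maj}(\Phi(\sigma))=\operatorname{maj}(\sigma)+\operatorname{imaj}(\sigma).$$
   Context: $\mathcal{S}_n$ is the symmetric group on $[n]=\{1,\dots,n\}$; $\mathcal{S}_n(231)$ is the set of $\sigma\in\mathcal{S}_n$ with no $i<j<k$ satisfying $\sigma_k<\sigma_i<\sigma_j$. For $\sigma\in\mathcal{S}_n$: $\operatorname{Des}(\sigma)=\{i : 1\le i<n,\ \sigma_i>\sigma_{i+1}\}$, $\operatorname{iDes}(\sigma)=\operatorname{Des}(\sigma^{-1})$, $\operatorname{maj}(\sigma)=\sum_{i\in\operatorname{Des}(\sigma)}i$, $\operatorname{imaj}(\sigma)=\operatorname{maj}(\sigma^{-1})$. A Dyck path of semilength $n$ is a word $D=D_1\cdots D_{2n}$ with $n$ letters $0$ (north steps) and $n$ letters $1$ (east steps) such that every prefix contains at least as many $0$'s as $1$'s; $\mathcal{D}_n$ is the set of these. It is identified with a lattice path from $(0,0)$ to $(n,n)$. A descent (or valley) of $D$ is an $i$ with $1\le i<2n$, $D_i=1$, $D_{i+1}=0$; $\operatorname{Des}(D)$ is the set of descents and $\operatorname{maj}(D)=\sum_{i\in\operatorname{Des}(D)}i$. The coordinates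 of the descent $i$ are $(x,y)$ with $x$ the number of $1$'s and $y$ the number of $0$'s among $D_1,\dots,D_i$. $\operatorname{Set}_X(D)$ and $\operatorname{Set}_Y(D)$ are the sets of $x$-coordinates and of $y$-coordinates of the descents of $D$. Definition of $\Phi$: for $\sigma\in\mathcal{S}_n(231)$ the sets $\operatorname{Des}(\sigma)=\{i_1<\dots<i_k\}$ and $\operatorname{iDes}(\sigma)=\{i'_1<\dots<i'_k\}$ have the same cardinality; set $i_{k+1}:=n$, $i'_{k+1}:=n$. Then $\Phi(\sigma)$ is the Dyck path consisting of $i'_1$ $0$'s, then $i_1$ $1$'s, then $i'_2-i'_1$ $0$'s, then $i_2-i_1$ $1$'s, and so on, ending with $i'_{k+1}-i'_k$ $0$'s and $i_{k+1}-i_k$ $1$'s (for $k=0$ it is $0^n1^n$). *)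

theory Defs
  imports "HOL-Combinatorics.Permutations"
begin

text \<open>A permutation of \<open>[n]\<close> is a function \<open>\<sigma>\<close> with \<open>\<sigma> permutes {1..n}\<close>; \<open>\<sigma> i\<close> is the
  letter \<open>\<sigma>\<^sub>i\<close> of its one-line notation.\<close>

definition Av231 :: "nat \<Rightarrow> (nat \<Rightarrow> nat) set" where
  "Av231 n = {\<sigma>. \<sigma> permutes {1..n} \<and>
     \<not> (\<exists>i j k. 1 \<le> i \<and> i < j \<and> j < k \<and> k \<le> n \<and> \<sigma> k < \<sigma> i \<and> \<sigma> i < \<sigma> j)}"

definition Des :: "nat \<Rightarrow> (nat \<Rightarrow> nat) \<Rightarrow> nat set" where
  "Des n \<sigma> = {i. 1 \<le> i \<and> i < n \<and> \<sigma> i > \<sigma> (i + 1)}"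

definition iDes :: "nat \<Rightarrow> (nat \<Rightarrow> nat) \<Rightarrow> nat set" where
  "iDes n \<sigma> = Des n (inv \<sigma>)"

definition maj :: "nat \<Rightarrow> (nat \<Rightarrow> nat) \<Rightarrow> nat" where
  "maj n \<sigma> = \<Sum> (Des n \<sigma>)"

definition imaj :: "nat \<Rightarrow> (nat \<Rightarrow> nat) \<Rightarrow> nat" where
  "imaj n \<sigma> = maj n (inv \<sigma>)"

text \<open>Paths are words over \<open>{0, 1}\<close>, with \<open>0\<close> a north and \<open>1\<close> an east step. Positions in a
  word are counted from 1, so the letter \<open>D\<^sub>i\<close> is \<open>D ! (i - 1)\<close>.\<close>

definition dyck_paths :: "nat \<Rightarrow> nat list set" where
  "dyck_paths n = {D. set D \<subseteq> {0, 1} \<and> count_list D 0 = n \<and> count_list D 1 = n \<and>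
     (\<forall>i \<le> length D. count_list (take i D) 1 \<le> count_list (take i D) 0)}"

definition path_Des :: "nat list \<Rightarrow> nat set" where
  "path_Des D = {i. 1 \<le> i \<and> i < length D \<and> D ! (i - 1) = 1 \<and> D ! i = 0}"

definition path_maj :: "nat list \<Rightarrow> nat" where
  "path_maj D = \<Sum> (path_Des D)"

definition Set_X :: "nat list \<Rightarrow> nat set" where
  "Set_X D = (\<lambda>i. count_list (take i D) 1) ` path_Des D"

definition Set_Y :: "nat list \<Rightarrow> nat set" where
  "Set_Y D = (\<lambda>i. count_list (take i D) 0) ` path_Des D"

text \<open>\<open>gaps [a\<^sub>1, a\<^sub>2, \<dots>] = [a\<^sub>1, a\<^sub>2 - a\<^sub>1, \<dots>]\<close>; it is only applied to increasing lists, so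
  the subtraction never truncates.\<close>

definition gaps :: "nat list \<Rightarrow> nat list" where
  "gaps xs = map2 (-) xs (0 # xs)"

text \<open>The lists zipped together in \<open>Phi\<close> have the same length when \<open>\<sigma> \<in> Av231 n\<close>, by
  \<open>card_iDes\<close> below; for other \<open>\<sigma>\<close> the value of \<open>Phi\<close> is meaningless.\<close>

definition Phi :: "nat \<Rightarrow> (nat \<Rightarrow> nat) \<Rightarrow> nat list" where
  "Phi n \<sigma> = concat (map2 (\<lambda>north east. replicate north 0 @ replicate east 1)
     (gaps (sorted_list_of_set (iDes n \<sigma>) @ [n]))
     (gaps (sorted_list_of_set (Des n \<sigma>) @ [n])))"

text \<open>\<open>Phi\<close> is well defined as a map from \<open>Av231 n\<close> to \<open>dyck_paths n\<close>.\<close>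

lemma finite_Des [simp]: "finite (Des n \<sigma>)" "finite (iDes n \<sigma>)"
  unfolding iDes_def Des_def by auto

lemma Av231_D:
  assumes "\<sigma> \<in> Av231 n" "1 \<le> i" "i < j" "j < k" "k \<le> n" "\<sigma> i < \<sigma> j"
  shows "\<sigma> i < \<sigma> k"
proof -
  have p: "\<sigma> permutes {1..n}" using assms(1) by (simp add: Av231_def)
  have "\<sigma> i \<noteq> \<sigma> k" using assms(3,4) inj_eq[OF permutes_inj[OF p], of i k] by simp
  moreover have "\<not> \<sigma> k < \<sigma> i" using assms unfolding Av231_def by blast
  ultimately show ?thesis by linarith
qed

lemma iDes_eq_image:
  assumes s: "\<sigma> \<in> Av231 n"
  shows "iDes n \<sigma> = (\<lambda>i. \<sigma> i - 1) ` Des n \<sigma>"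
proof -
  have p: "\<sigma> permutes {1..n}" using s by (simp add: Av231_def)
  have r: "\<sigma> i \<in> {1..n}" if "i \<in> {1..n}" for i using permutes_in_image[OF p] that by blast
  have r': "inv \<sigma> i \<in> {1..n}" if "i \<in> {1..n}" for i
    using permutes_in_image[OF permutes_inv[OF p]] that by blast
  have inv: "\<sigma> (inv \<sigma> i) = i" "inv \<sigma> (\<sigma> i) = i" for i using permutes_inverses[OF p] by auto
  show ?thesis
  proof (intro equalityI subsetI)
    fix v assume "v \<in> iDes n \<sigma>"
    hence v: "1 \<le> v" "v < n" "inv \<sigma> (v + 1) < inv \<sigma> v" by (auto simp: iDes_def Des_def)
    define q where "q = inv \<sigma> (v + 1)"
    have q: "1 \<le> q" "q < inv \<sigma> v" "inv \<sigma> v \<le> n" "\<sigma> q = v + 1"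
      using v r'[of "v + 1"] r'[of v] by (auto simp: q_def inv)
    have "\<sigma> q > \<sigma> (q + 1)"
    proof (cases "q + 1 = inv \<sigma> v")
      case True thus ?thesis by (simp add: inv q)
    next
      case False
      hence "\<not> \<sigma> q < \<sigma> (q + 1)" using Av231_D[OF s, of q "q + 1" "inv \<sigma> v"] q by (auto simp: inv)
      moreover have "\<sigma> q \<noteq> \<sigma> (q + 1)" using inj_eq[OF permutes_inj[OF p], of q "q + 1"] by simp
      ultimately show ?thesis by linarith
    qed
    hence "q \<in> Des n \<sigma>" using q by (auto simp: Des_def)
    thus "v \<in> (\<lambda>i. \<sigma> i - 1) ` Des n \<sigma>" using q by force
  next
    fix v assume "v \<in> (\<lambda>i. \<sigma> i - 1) ` Des n \<sigma>"
    then obtain i where i: "1 \<le> i" "i < n" "\<sigma> (i + 1) < \<sigma> i" "v = \<sigma> i - 1"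
      by (auto simp: Des_def)
    have b: "1 \<le> \<sigma> (i + 1)" "\<sigma> i \<le> n" using r[of "i + 1"] r[of i] i by auto
    hence v: "1 \<le> v" "v < n" "\<sigma> i = v + 1" using i by auto
    have iv: "inv \<sigma> (v + 1) = i" using v(3) inv(2)[of i] by simp
    have "\<not> inv \<sigma> v < i"
    proof
      assume "inv \<sigma> v < i"
      thus False using Av231_D[OF s, of "inv \<sigma> v" i "i + 1"] i(1-3) v r'[of v] by (auto simp: inv)
    qed
    moreover have "inv \<sigma> v \<noteq> i" using v inv(1)[of v] by auto
    ultimately show "v \<in> iDes n \<sigma>" using v(1,2) iv by (auto simp: iDes_def Des_def)
  qed
qed

lemma card_iDes:
  assumes s: "\<sigma> \<in> Av231 n"
  shows "card (iDes n \<sigma>) = card (Des n \<sigma>)"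
proof -
  have p: "\<sigma> permutes {1..n}" using s by (simp add: Av231_def)
  have "inj_on (\<lambda>i. \<sigma> i - 1) (Des n \<sigma>)"
  proof (rule inj_onI)
    fix i j assume "i \<in> Des n \<sigma>" "j \<in> Des n \<sigma>" "\<sigma> i - 1 = \<sigma> j - 1"
    hence "\<sigma> i = \<sigma> j" by (auto simp: Des_def)
    thus "i = j" using inj_eq[OF permutes_inj[OF p]] by blast
  qed
  thus ?thesis using iDes_eq_image[OF s] card_image by metis
qed

lemma card_iDes_le:
  assumes s: "\<sigma> \<in> Av231 n"
  shows "card {v \<in> iDes n \<sigma>. v \<le> m} \<le> card {i \<in> Des n \<sigma>. i \<le> m}"
proof -
  have p: "\<sigma> permutes {1..n}" using s by (simp add: Av231_def)
  have r: "\<sigma> i \<in> {1..n}" if "i \<in> {1..n}" for i using permutes_in_image[OF p] that by blast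
  have r': "inv \<sigma> i \<in> {1..n}" if "i \<in> {1..n}" for i
    using permutes_in_image[OF permutes_inv[OF p]] that by blast
  have inv: "\<sigma> (inv \<sigma> i) = i" "inv \<sigma> (\<sigma> i) = i" for i using permutes_inverses[OF p] by auto
  have inj: "inj \<sigma>" by (rule permutes_inj[OF p])
  let ?N = "{i. 1 \<le> i \<and> i < n \<and> i \<le> m}"
  let ?A = "{i \<in> ?N. \<sigma> i < \<sigma> (i + 1)}"
  let ?B = "{v \<in> ?N. inv \<sigma> v < inv \<sigma> (v + 1)}"
  let ?L = "\<lambda>i. \<sigma> ` {j. 1 \<le> j \<and> j \<le> i \<and> \<sigma> j < \<sigma> (i + 1)}"
  have fL: "finite (?L i)" for i by auto
  define u where "u i = Max (?L i)" for i
  have L: "?L i = {1..u i}" "\<sigma> i \<le> u i" "u i < \<sigma> (i + 1)" "inv \<sigma> (u i) \<le> i" "i < inv \<sigma> (u i + 1)" "1 \<le> u i" "u i \<le> i"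
    if i: "i \<in> ?A" for i
  proof -
    have ne: "\<sigma> i \<in> ?L i" using i by auto
    hence mem: "u i \<in> ?L i" unfolding u_def using fL[of i] by (intro Max_in) auto
    have up: "x \<le> u i" if "x \<in> ?L i" for x unfolding u_def using that fL[of i] by (intro Max_ge) auto
    show "\<sigma> i \<le> u i" by (rule up[OF ne])
    obtain j where j: "1 \<le> j" "j \<le> i" "\<sigma> j < \<sigma> (i + 1)" "u i = \<sigma> j" using mem by auto
    show lt: "u i < \<sigma> (i + 1)" using j by simp
    show "inv \<sigma> (u i) \<le> i" using j by (simp add: inv)
    show eq: "?L i = {1..u i}"
    proof (intro equalityI subsetI)
      fix x assume x: "x \<in> ?L i"
      then obtain k where k: "1 \<le> k" "k \<le> i" "x = \<sigma> k" by auto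
      have "1 \<le> x" using r[of k] k i by auto
      thus "x \<in> {1..u i}" using up[OF x] by auto
    next
      fix x assume x: "x \<in> {1..u i}"
      have xn: "x \<in> {1..n}" using x lt r[of "i + 1"] i by auto
      have "inv \<sigma> x \<le> i"
      proof (rule ccontr)
        assume a: "\<not> inv \<sigma> x \<le> i"
        have "inv \<sigma> x \<noteq> i + 1" using x lt inv(1)[of x] by auto
        hence "i + 1 < inv \<sigma> x" using a by auto
        hence "\<sigma> j < x" using Av231_D[OF s, of j "i + 1" "inv \<sigma> x"] j r'[OF xn] by (auto simp: inv)
        thus False using x j by auto
      qed
      hence "inv \<sigma> x \<in> {j. 1 \<le> j \<and> j \<le> i \<and> \<sigma> j < \<sigma> (i + 1)}" using r'[OF xn] x lt by (auto simp: inv)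
      hence "\<sigma> (inv \<sigma> x) \<in> ?L i" by (rule imageI)
      thus "x \<in> ?L i" by (simp add: inv)
    qed
    show "1 \<le> u i" using r[of j] j i by auto
    have "u i = card (?L i)" using eq by simp
    also have "\<dots> \<le> card {j. 1 \<le> j \<and> j \<le> i \<and> \<sigma> j < \<sigma> (i + 1)}" by (rule card_image_le) auto
    also have "\<dots> \<le> card {1..i}" by (rule card_mono) auto
    finally show "u i \<le> i" by simp
    show "i < inv \<sigma> (u i + 1)"
    proof (rule ccontr)
      assume a: "\<not> i < inv \<sigma> (u i + 1)"
      have n1: "u i + 1 \<in> {1..n}" using lt r[of "i + 1"] i by auto
      have "u i + 1 \<noteq> \<sigma> (i + 1)" using a inv(2)[of "i + 1"] by auto
      hence "u i + 1 < \<sigma> (i + 1)" using lt by auto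
      hence "inv \<sigma> (u i + 1) \<in> {j. 1 \<le> j \<and> j \<le> i \<and> \<sigma> j < \<sigma> (i + 1)}" using a r'[OF n1] by (auto simp: inv)
      hence "\<sigma> (inv \<sigma> (u i + 1)) \<in> ?L i" by (rule imageI)
      hence "u i + 1 \<le> u i" using up by (simp only: inv)
      thus False by simp
    qed
  qed
  have le_imp: False if "i \<in> ?A" "i' \<in> ?A" "u i = u i'" "i < i'" for i i'
  proof -
    have "\<sigma> i' \<in> {1..u i}" using L(2)[OF that(2)] that r[of i'] by auto
    hence "\<sigma> i' \<in> ?L i" using L(1)[OF that(1)] by simp
    then obtain j where "j \<le> i" "\<sigma> i' = \<sigma> j" by auto
    thus False using injD[OF inj, of i' j] that by auto
  qed
  have "inj_on u ?A"
  proof (rule inj_onI)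
    fix x y assume xy: "x \<in> ?A" "y \<in> ?A" "u x = u y"
    show "x = y" using le_imp[OF xy] le_imp[OF xy(2,1) xy(3)[symmetric]] by (meson nat_neq_iff)
  qed
  moreover have "u ` ?A \<subseteq> ?B"
  proof
    fix x assume "x \<in> u ` ?A"
    then obtain i where i: "i \<in> ?A" "x = u i" by blast
    show "x \<in> ?B" using L(4,5,6,7)[OF i(1)] i by auto
  qed
  ultimately have AB: "card ?A \<le> card ?B" by (intro card_inj_on_le) auto
  have split: "card {i \<in> ?N. f (i + 1) < f i} + card {i \<in> ?N. f i < f (i + 1)} = card ?N"
    if "inj f" for f :: "nat \<Rightarrow> nat"
  proof -
    have ne: "f i \<noteq> f (i + 1)" for i using inj_eq[OF that, of i "i + 1"] by simp
    hence "f (i + 1) < f i \<or> f i < f (i + 1)" for i by (metis nat_neq_iff)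
    hence "{i \<in> ?N. f (i + 1) < f i} \<union> {i \<in> ?N. f i < f (i + 1)} = ?N" by blast
    moreover have "card ({i \<in> ?N. f (i + 1) < f i} \<union> {i \<in> ?N. f i < f (i + 1)}) =
      card {i \<in> ?N. f (i + 1) < f i} + card {i \<in> ?N. f i < f (i + 1)}"
      by (rule card_Un_disjoint) auto
    ultimately show ?thesis by simp
  qed
  have e: "{i \<in> Des n f. i \<le> m} = {i \<in> ?N. f (i + 1) < f i}" for f
    by (auto simp: Des_def)
  show ?thesis
    unfolding iDes_def e using split[OF inj] split[OF permutes_inj[OF permutes_inv[OF p]]] AB by linarith
qed

lemma sorted_list_of_set_le:
  fixes A B :: "nat set"
  assumes fin: "finite A" "finite B" and c: "card B = card A"
    and le: "\<And>m. card {v \<in> B. v \<le> m} \<le> card {v \<in> A. v \<le> m}"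
  shows "list_all2 (\<le>) (sorted_list_of_set A) (sorted_list_of_set B)"
proof (rule list_all2_all_nthI)
  show "length (sorted_list_of_set A) = length (sorted_list_of_set B)" using c by simp
  fix j assume j: "j < length (sorted_list_of_set A)"
  let ?xs = "sorted_list_of_set A" and ?ys = "sorted_list_of_set B"
  have jB: "j < length ?ys" using j c by simp
  show "?xs ! j \<le> ?ys ! j"
  proof (rule ccontr)
    assume "\<not> ?xs ! j \<le> ?ys ! j"
    hence lt: "?ys ! j < ?xs ! j" by simp
    let ?m = "?ys ! j"
    have "set (take (Suc j) ?ys) \<subseteq> {v \<in> B. v \<le> ?m}"
    proof
      fix x assume "x \<in> set (take (Suc j) ?ys)"
      then obtain i where i: "i \<le> j" "x = ?ys ! i" using jB by (auto simp: in_set_conv_nth less_Suc_eq_le)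
      have "x \<in> B" using i jB fin nth_mem[of i ?ys] by simp
      thus "x \<in> {v \<in> B. v \<le> ?m}" using i jB sorted_nth_mono[of ?ys i j] by auto
    qed
    hence "card (set (take (Suc j) ?ys)) \<le> card {v \<in> B. v \<le> ?m}" using fin by (intro card_mono) auto
    hence 1: "Suc j \<le> card {v \<in> B. v \<le> ?m}" using jB by (simp add: distinct_card distinct_take)
    have "{v \<in> A. v \<le> ?m} \<subseteq> set (take j ?xs)"
    proof
      fix x assume x: "x \<in> {v \<in> A. v \<le> ?m}"
      hence "x \<in> set ?xs" using fin by simp
      then obtain i where i: "i < length ?xs" "x = ?xs ! i" by (auto simp: in_set_conv_nth)
      have "i < j"
      proof (rule ccontr)
        assume "\<not> i < j"
        hence "?xs ! j \<le> ?xs ! i" using i by (intro sorted_nth_mono) auto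
        thus False using x i lt by auto
      qed
      thus "x \<in> set (take j ?xs)" using i by (auto simp: in_set_conv_nth)
    qed
    hence "card {v \<in> A. v \<le> ?m} \<le> card (set (take j ?xs))" by (intro card_mono) auto
    also have "\<dots> \<le> j" using card_length[of "take j ?xs"] by simp
    finally show False using 1 le[of ?m] by linarith
  qed
qed

lemma count_list_replicate': "count_list (replicate k x) y = (if x = y then k else 0)"
  by (induction k) auto

lemma word_of_gaps:
  assumes "list_all2 (\<le>) xs ys" "sorted (a # xs)" "sorted (b # ys)" "a \<le> b"
  defines "w \<equiv> concat (map2 (\<lambda>n e. replicate n 0 @ replicate e (1::nat))
     (map2 (-) ys (b # ys)) (map2 (-) xs (a # xs)))"
  shows "set w \<subseteq> {0, 1} \<and> b + count_list w 0 = last (b # ys) \<and> a + count_list w 1 = last (a # xs) \<and>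
    (\<forall>i. a + count_list (take i w) 1 \<le> b + count_list (take i w) 0)"
  unfolding w_def using assms(1-4)
proof (induction xs ys arbitrary: a b rule: list_all2_induct)
  case Nil
  thus ?case by simp
next
  case (Cons x xs y ys)
  let ?w = "concat (map2 (\<lambda>n e. replicate n 0 @ replicate e (1::nat))
     (map2 (-) ys (y # ys)) (map2 (-) xs (x # xs)))"
  have IH: "set ?w \<subseteq> {0, 1}" "y + count_list ?w 0 = last (y # ys)" "x + count_list ?w 1 = last (x # xs)"
    "x + count_list (take i ?w) 1 \<le> y + count_list (take i ?w) 0" for i
    using Cons.IH[of x y] Cons.prems Cons.hyps by simp_all
  have ab: "a \<le> x" "b \<le> y" "x \<le> y" "a \<le> b" using Cons.prems Cons.hyps by auto
  let ?W = "replicate (y - b) 0 @ replicate (x - a) 1 @ ?w"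
  have 1: "a + count_list (take i ?W) 1 \<le> b + count_list (take i ?W) 0" for i
  proof (cases "i \<le> (y - b) + (x - a)")
    case True
    thus ?thesis using ab by (auto simp: count_list_replicate' min_def)
  next
    case False
    thus ?thesis using ab IH(4)[of "i - (y - b) - (x - a)"]
      by (auto simp: count_list_replicate' min_def)
  qed
  show ?case using 1 IH(1-3) ab by (auto simp: count_list_replicate')
qed

lemma Phi_in_dyck_paths:
  assumes s: "\<sigma> \<in> Av231 n"
  shows "Phi n \<sigma> \<in> dyck_paths n"
proof -
  let ?xs = "sorted_list_of_set (Des n \<sigma>) @ [n]" and ?ys = "sorted_list_of_set (iDes n \<sigma>) @ [n]"
  have a: "list_all2 (\<le>) ?xs ?ys"
    using sorted_list_of_set_le[OF _ _ card_iDes[OF s] card_iDes_le[OF s]]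
    by (intro list_all2_appendI) auto
  have "sorted (0 # ?xs)" "sorted (0 # ?ys)"
    by (auto simp: sorted_append) (auto simp: iDes_def Des_def)
  from word_of_gaps[OF a this] show ?thesis
    unfolding Phi_def gaps_def dyck_paths_def by auto
qed

end

theory Submission
  imports Defs
begin

text \<open>A path made of blocks, each consisting of some north steps followed by some east steps
  and none of these runs being empty, has its valleys exactly where two consecutive blocks meet.
  The blocks of \<open>Phi n \<sigma>\<close> are the gaps between consecutive elements of \<open>iDes n \<sigma>\<close> and of
  \<open>Des n \<sigma>\<close>, each completed by \<open>0\<close> and \<open>n\<close>; as both sets lie strictly between \<open>0\<close> and \<open>n\<close>, the
  gaps are positive. If \<open>j\<close> is between 1 and the size of these sets, then after \<open>j\<close> blocks the
  path has reached the point \<open>(x, y)\<close> whose coordinates are the \<open>j\<close>-th smallest elements of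
  \<open>Des n \<sigma>\<close> and \<open>iDes n \<sigma>\<close>. Since \<open>Des n \<sigma>\<close> and \<open>iDes n \<sigma>\<close> have
  the same size (\<open>card_iDes\<close>), this describes all valleys, and it gives both coordinate sets.
  A valley at \<open>(x, y)\<close> occurs after \<open>x + y\<close> steps, and summing over the valleys gives the
  identity of major indices. The induction over the blocks is done in
  \<open>path_Des_staircase\<close> and \<open>count_list_take_staircase\<close>.\<close>

text \<open>The path from \<open>(a, b)\<close> which goes to each of the points of \<open>zip xs ys\<close> in turn, each time
  first north and then east. The lists are meant to be increasing and of equal length.\<close>

fun staircase :: "nat \<Rightarrow> nat \<Rightarrow> nat list \<Rightarrow> nat list \<Rightarrow> nat list" where
  "staircase a b (x # xs) (y # ys) =
     replicate (y - b) 0 @ replicate (x - a) 1 @ staircase x y xs ys"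
| "staircase a b _ _ = []"

lemma concat_gaps_eq_staircase:
  "concat (map2 (\<lambda>north east. replicate north 0 @ replicate east 1)
     (map2 (-) ys (b # ys)) (map2 (-) xs (a # xs))) = staircase a b xs ys"
  by (induction a b xs ys rule: staircase.induct) auto

lemma Phi_eq_staircase:
  "Phi n \<sigma> = staircase 0 0 (sorted_list_of_set (Des n \<sigma>) @ [n])
     (sorted_list_of_set (iDes n \<sigma>) @ [n])"
  unfolding Phi_def gaps_def by (rule concat_gaps_eq_staircase)

lemma path_Des_Nil [simp]: "path_Des [] = {}"
  by (simp add: path_Des_def)

lemma path_Des_Cons:
  "path_Des (c # w) = (if c = 1 \<and> w \<noteq> [] \<and> hd w = 0 then {1} else {}) \<union> Suc ` path_Des w"
proof (rule set_eqI)
  fix i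
  show "i \<in> path_Des (c # w) \<longleftrightarrow>
      i \<in> (if c = 1 \<and> w \<noteq> [] \<and> hd w = 0 then {1} else {}) \<union> Suc ` path_Des w"
  proof (cases i)
    case 0
    thus ?thesis by (auto simp: path_Des_def)
  next
    case (Suc j)
    have "i \<in> Suc ` path_Des w \<longleftrightarrow> j \<in> path_Des w"
      using Suc by auto
    thus ?thesis using Suc by (cases j) (auto simp: path_Des_def hd_conv_nth)
  qed
qed

lemma path_Des_replicate_0_append:
  "path_Des (replicate p 0 @ w) = (+) p ` path_Des w"
  by (induction p) (auto simp: path_Des_Cons image_iff)

lemma path_Des_replicate_1_append:
  assumes "0 < q"
  shows "path_Des (replicate q 1 @ w) =
    (if w \<noteq> [] \<and> hd w = 0 then {q} else {}) \<union> (+) q ` path_Des w"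
  using assms
proof (induction q rule: nat_induct_non_zero)
  case 1
  show ?case by (simp add: path_Des_Cons)
next
  case (Suc q)
  have "hd (replicate q 1 @ w) = (1::nat)" using Suc.hyps by (cases q) auto
  hence "path_Des (replicate (Suc q) 1 @ w) = Suc ` path_Des (replicate q 1 @ w)"
    by (simp add: path_Des_Cons)
  thus ?case unfolding Suc.IH by (auto simp: image_iff)
qed

lemma path_Des_block_append:
  assumes "0 < q"
  shows "path_Des (replicate p 0 @ replicate q 1 @ w) =
    (if w \<noteq> [] \<and> hd w = 0 then {p + q} else {}) \<union> (+) (p + q) ` path_Des w"
  unfolding path_Des_replicate_0_append path_Des_replicate_1_append[OF assms]
  by (auto simp: image_iff algebra_simps)

text \<open>The end point of a staircase is not a valley, hence the elements \<open>m\<close> and \<open>m'\<close> at the end.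
  In the induction the starting point moves; adding \<open>a + b\<close> turns the number of steps already
  taken into the sum of the coordinates of the point reached.\<close>

lemma path_Des_staircase:
  assumes "length xs = length ys"
    and "sorted_wrt (<) (a # xs @ [m])" and "sorted_wrt (<) (b # ys @ [m'])"
  shows "(+) (a + b) ` path_Des (staircase a b (xs @ [m]) (ys @ [m'])) = set (map2 (+) xs ys)"
  using assms
proof (induction xs ys arbitrary: a b rule: list_induct2)
  case Nil
  thus ?case using path_Des_block_append[of "m - a" "m' - b" "[]"] by simp
next
  case (Cons x xs y ys)
  let ?w = "staircase x y (xs @ [m]) (ys @ [m'])"
  have lt: "a < x" "b < y" using Cons.prems by auto
  have IH: "(+) (x + y) ` path_Des ?w = set (map2 (+) xs ys)"
    using Cons.prems by (intro Cons.IH) auto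
  have w: "?w \<noteq> [] \<and> hd ?w = 0"
  proof -
    obtain u us where u: "xs @ [m] = u # us" by (cases xs) auto
    obtain v vs where v: "ys @ [m'] = v # vs" by (cases ys) auto
    have "y < v" using Cons.prems(2) v by auto
    then obtain d where "v - y = Suc d" by (metis Suc_diff_Suc)
    thus ?thesis by (simp add: u v)
  qed
  have shift: "a + b + ((y - b) + (x - a)) = x + y" using lt by simp
  have "path_Des (staircase a b ((x # xs) @ [m]) ((y # ys) @ [m'])) =
      insert ((y - b) + (x - a)) ((+) ((y - b) + (x - a)) ` path_Des ?w)"
    using path_Des_block_append[of "x - a" "y - b" ?w] lt w by simp
  hence "(+) (a + b) ` path_Des (staircase a b ((x # xs) @ [m]) ((y # ys) @ [m'])) =
      insert (x + y) ((+) (x + y) ` path_Des ?w)"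
    by (simp only: image_insert image_image add.assoc[symmetric] shift[unfolded add.assoc[symmetric]])
  thus ?case by (simp add: IH)
qed

lemma count_list_take_staircase:
  assumes "length xs = length ys"
    and "sorted (a # xs)" and "sorted (b # ys)" and "(x, y) \<in> set (zip xs ys)"
  shows "a + count_list (take (x + y - (a + b)) (staircase a b (xs @ us) (ys @ vs))) 1 = x \<and>
    b + count_list (take (x + y - (a + b)) (staircase a b (xs @ us) (ys @ vs))) 0 = y"
  using assms
proof (induction xs ys arbitrary: a b rule: list_induct2)
  case Nil
  thus ?case by simp
next
  case (Cons x' xs y' ys)
  have le: "a \<le> x'" "b \<le> y'" "x' \<le> x" "y' \<le> y"
    using Cons.prems by (auto dest: set_zip_leftD set_zip_rightD)
  let ?w = "staircase x' y' (xs @ us) (ys @ vs)"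
  let ?k = "x + y - (x' + y')"
  have "x' + count_list (take ?k ?w) 1 = x \<and> y' + count_list (take ?k ?w) 0 = y"
  proof (cases "(x, y) = (x', y')")
    case True
    thus ?thesis by simp
  next
    case False
    thus ?thesis using Cons.prems by (intro Cons.IH) auto
  qed
  moreover have "take (x + y - (a + b)) (staircase a b ((x' # xs) @ us) ((y' # ys) @ vs)) =
      replicate (y' - b) 0 @ replicate (x' - a) 1 @ take ?k ?w"
  proof -
    have "x + y - (a + b) = (y' - b) + ((x' - a) + ?k)" using le by simp
    thus ?thesis by (simp only:) simp
  qed
  ultimately show ?case using le by (simp add: count_list_replicate' del: staircase.simps)
qed

lemma sorted_wrt_less_map2_add:
  fixes xs ys :: "nat list"
  assumes "length xs = length ys" "sorted_wrt (<) xs" "sorted_wrt (<) ys"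
  shows "sorted_wrt (<) (map2 (+) xs ys)"
  using assms by (auto simp: sorted_wrt_iff_nth_less intro: add_strict_mono)

lemma sum_list_map2_add:
  fixes xs ys :: "'a::comm_monoid_add list"
  assumes "length xs = length ys"
  shows "sum_list (map2 (+) xs ys) = sum_list xs + sum_list ys"
  using assms by (induction xs ys rule: list_induct2) (auto simp: ac_simps)

theorem corollary3p12:
  fixes n :: nat and \<sigma> :: "nat \<Rightarrow> nat"
  assumes "n \<ge> 1" and "\<sigma> \<in> Av231 n"
  shows "Set_X (Phi n \<sigma>) = Des n \<sigma> \<and>
         Set_Y (Phi n \<sigma>) = iDes n \<sigma> \<and>
         path_maj (Phi n \<sigma>) = maj n \<sigma> + imaj n \<sigma>"
proof -
  define xs where "xs = sorted_list_of_set (Des n \<sigma>)"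
  define ys where "ys = sorted_list_of_set (iDes n \<sigma>)"
  have set: "set xs = Des n \<sigma>" "set ys = iDes n \<sigma>" by (simp_all add: xs_def ys_def)
  have len: "length xs = length ys" by (simp add: xs_def ys_def card_iDes[OF assms(2)])
  have strict: "sorted_wrt (<) xs" "sorted_wrt (<) ys" by (simp_all add: xs_def ys_def)
  \<comment> \<open>\<open>n \<ge> 1\<close> is needed when there are no descents.\<close>
  have strict': "sorted_wrt (<) (0 # xs @ [n])" "sorted_wrt (<) (0 # ys @ [n])"
    using strict assms(1) by (auto simp: sorted_wrt_append set iDes_def Des_def)
  have Phi: "Phi n \<sigma> = staircase 0 0 (xs @ [n]) (ys @ [n])"
    by (simp add: Phi_eq_staircase xs_def ys_def)
  have Des: "path_Des (Phi n \<sigma>) = set (map2 (+) xs ys)"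
    using path_Des_staircase[OF len strict'] by (simp add: Phi image_def)
  have count: "count_list (take (x + y) (Phi n \<sigma>)) 1 = x"
      "count_list (take (x + y) (Phi n \<sigma>)) 0 = y" if "(x, y) \<in> set (zip xs ys)" for x y
    using count_list_take_staircase[OF len _ _ that, of 0 0 "[n]" "[n]"] strict
    by (simp_all add: Phi strict_sorted_imp_sorted)
  have "Set_X (Phi n \<sigma>) = fst ` set (zip xs ys)"
    unfolding Set_X_def Des set_map image_image
    by (intro image_cong refl) (auto simp: count[simplified])
  hence X: "Set_X (Phi n \<sigma>) = Des n \<sigma>"
    using len by (simp add: set_map[symmetric] set del: set_map)
  have "Set_Y (Phi n \<sigma>) = snd ` set (zip xs ys)"
    unfolding Set_Y_def Des set_map image_image
    by (intro image_cong refl) (auto simp: count[simplified])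
  hence Y: "Set_Y (Phi n \<sigma>) = iDes n \<sigma>"
    using len by (simp add: set_map[symmetric] set del: set_map)
  have "path_maj (Phi n \<sigma>) = sum_list (map2 (+) xs ys)"
    using sorted_wrt_less_map2_add[OF len strict]
    by (simp only: path_maj_def Des sum_list_distinct_conv_sum_set[of _ "\<lambda>x. x", simplified]
      strict_sorted_iff)
  also have "\<dots> = sum_list xs + sum_list ys" by (rule sum_list_map2_add[OF len])
  also have "\<dots> = \<Sum> (Des n \<sigma>) + \<Sum> (iDes n \<sigma>)"
    using strict set
    by (simp add: strict_sorted_iff sum_list_distinct_conv_sum_set[of _ "\<lambda>x. x", simplified])
  finally have "path_maj (Phi n \<sigma>) = maj n \<sigma> + imaj n \<sigma>"
    by (simp add: maj_def imaj_def iDes_def)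
  with X Y show ?thesis by blast
qed

end
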